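(* For all positive integers $m$ and $k$, $f(m,k) \leq m\, f\!\left(\left\lceil \frac{k-m+1}{m} \right\rceil\right)$. In particular, for fixed $m$ and large $k$, $f(m,k) \leq (\log(2) + O(1))\, \frac{k^2}{m}\, 2^{k/m}$, where $\log$ is the natural logarithm.
   Context: A tournament is a directed graph obtained by orienting each edge of a complete graph (no loops). In a tournament, a vertex $u$ dominates a set of vertices $U$ (written $u \rightarrow U$) if $(u,w)$ is an edge for every $w \in U$ (in particular $u \notin U$). Let $\tau = \{T_1, \dots, T_m\}$ be a collection of $m$ labeled tournaments, all on the same vertex set $V(\tau)$ (repetitions among the $T_i$ allowed). The collection $\tau$ has Schütte's property $S_k$ if for every $k$-element subset $U \subseteq V(\tau)$ there exist an index $i$ and a vertex $u \in V(\tau)$ with $u \rightarrow U$ in $T_i$. For positive integers $m$ and nonnegative integers $k$, $f(m,k)$ denotes the minimum size of a vertex set $V$ such that there is a collection of $m$ tournaments on $V$ having property $S_k$. For a nonnegative integer $j$, $f(j) = f(1,j)$ is the smallest order of a single tournament with property $S_j$ (so $f(0)=1$). *)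

theory Defs
  imports Complex_Main "HOL-Library.Landau_Symbols"
begin

definition tournament :: "'a set \<Rightarrow> 'a rel \<Rightarrow> bool" where
  "tournament V E \<longleftrightarrow> E \<subseteq> V \<times> V \<and> asym E \<and> total_on V E"

definition dominates :: "'a rel \<Rightarrow> 'a \<Rightarrow> 'a set \<Rightarrow> bool" where
  "dominates E u U \<longleftrightarrow> (\<forall>w\<in>U. (u, w) \<in> E)"

text \<open>A labeled collection of \<open>m\<close> tournaments on \<open>V\<close>
  is a family \<open>T\<close> of which only the members \<open>T i\<close> with \<open>i < m\<close> matter.\<close>

definition schutte_property :: "'a set \<Rightarrow> nat \<Rightarrow> (nat \<Rightarrow> 'a rel) \<Rightarrow> nat \<Rightarrow> bool" where
  "schutte_property V m T k \<longleftrightarrow>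
     (\<forall>U. U \<subseteq> V \<and> finite U \<and> card U = k \<longrightarrow> (\<exists>i<m. \<exists>u\<in>V. dominates (T i) u U))"

text \<open>\<open>schutte_number m k\<close> is $f(m,k)$, and \<open>schutte_number 1 j\<close> is $f(j)$.
  Vertex sets with fewer than \<open>k\<close> elements have no \<open>k\<close>-element subset, so they satisfy
  the property vacuously; the conjunct \<open>k \<le> n\<close> excludes them, since otherwise the
  minimum would be 0 for all \<open>k \<ge> 1\<close>. As only cardinalities matter, vertex sets are
  taken without loss of generality to be sets of natural numbers.\<close>

definition schutte_number :: "nat \<Rightarrow> nat \<Rightarrow> nat" where
  "schutte_number m k = (LEAST n. k \<le> n \<and>
     (\<exists>(V :: nat set) T. finite V \<and> card V = n \<and>
        (\<forall>i<m. tournament V (T i)) \<and> schutte_property V m T k))"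

end

theory Submission
  imports Defs
begin

text \<open>Put \<open>j = k div m\<close>, which is the rounded-up quotient of the statement, and take \<open>m\<close> disjoint
  copies of a tournament with property \<open>S\<^sub>j\<close>. In the \<open>i\<close>-th tournament let the \<open>i\<close>-th copy beat all
  the others. As \<open>k < m * (j + 1)\<close>, every \<open>k\<close>-set meets some copy in at most \<open>j\<close> vertices, which are
  dominated inside that copy, and their dominator also beats everything outside it.
  The asymptotic bound follows from Erdos' counting argument: for \<open>n = 4 * j\<^sup>2 * 2 ^ j\<close> fewer than all
  orientations of the complete graph on \<open>n\<close> vertices fail to have \<open>S\<^sub>j\<close>.\<close>

section \<open>Transport of vertex sets to the natural numbers\<close>

text \<open>\<open>schutte_number\<close> ranges over sets of naturals only, while the disjoint
  copies live on pairs. Pushing the relations forward along an injection into the naturals preserves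
  cardinality, tournaments and domination.\<close>

lemma schutte_number_le:
  fixes V :: "'a set" and T :: "nat \<Rightarrow> 'a rel"
  assumes "finite V" "k \<le> card V" "\<And>i. i < m \<Longrightarrow> tournament V (T i)" "schutte_property V m T k"
  shows "schutte_number m k \<le> card V"
proof -
  obtain f :: "'a \<Rightarrow> nat" where f: "inj_on f V"
    using finite_imp_inj_to_nat_seg[OF assms(1)] by blast
  define T' where "T' i = map_prod f f ` T i" for i
  have tour: "tournament (f ` V) (T' i)" if "i < m" for i
  proof -
    have sub: "T i \<subseteq> V \<times> V" and as: "asym (T i)" and tot: "total_on V (T i)"
      using assms(3)[OF that] by (auto simp: tournament_def)
    have "asym (T' i)"
    proof (rule asymI)
      fix a b assume "(a, b) \<in> T' i"
      then obtain x y where xy: "(x, y) \<in> T i" "a = f x" "b = f y" by (auto simp: T'_def)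
      show "(b, a) \<notin> T' i"
      proof
        assume "(b, a) \<in> T' i"
        then obtain x' y' where "(y', x') \<in> T i" "a = f x'" "b = f y'" by (auto simp: T'_def)
        moreover from this xy sub f have "x' = x" "y' = y" by (auto dest: inj_onD)
        ultimately have "(y, x) \<in> T i" by simp
        with as xy show False by (auto dest: asymD)
      qed
    qed
    moreover have "total_on (f ` V) (T' i)"
      using tot by (fastforce simp: total_on_def T'_def)
    ultimately show ?thesis using sub by (auto simp: tournament_def T'_def)
  qed
  have "schutte_property (f ` V) m T' k"
    unfolding schutte_property_def
  proof (intro allI impI, elim conjE)
    fix U assume U: "U \<subseteq> f ` V" "finite U" "card U = k"
    then obtain U' where U': "U' \<subseteq> V" "U = f ` U'" by (auto simp: subset_image_iff)
    have "inj_on f U'" using f U' inj_on_subset by blast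
    then have "card U' = k" using U U' by (simp add: card_image)
    moreover have "finite U'" using U' assms(1) finite_subset by blast
    ultimately obtain i u where iu: "i < m" "u \<in> V" "dominates (T i) u U'"
      using assms(4) U' unfolding schutte_property_def by blast
    then have "dominates (T' i) (f u) U" using U' by (force simp: dominates_def T'_def)
    with iu show "\<exists>i<m. \<exists>u\<in>f ` V. dominates (T' i) u U" by blast
  qed
  moreover have "card (f ` V) = card V" using f by (rule card_image)
  ultimately show ?thesis
    unfolding schutte_number_def using assms(1,2) tour
    by (intro Least_le) (metis finite_imageI)
qed

section \<open>Counting argument for a single tournament\<close>

text \<open>In probabilistic terms: a random subset of \<open>P\<close> has independent traces on
  the disjoint blocks \<open>A u\<close>, and each trace avoids its forbidden pattern with
  probability \<open>1 - 1 / 2 ^ k\<close>. Denominators are cleared to stay in the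
  naturals.\<close>

lemma card_Pow_avoiding_patterns:
  assumes "finite I" "finite P" "\<And>u. u \<in> I \<Longrightarrow> B u \<subseteq> A u" "\<And>u. u \<in> I \<Longrightarrow> A u \<subseteq> P"
    and "\<And>u. u \<in> I \<Longrightarrow> card (A u) = k"
    and "\<And>u v. u \<in> I \<Longrightarrow> v \<in> I \<Longrightarrow> u \<noteq> v \<Longrightarrow> A u \<inter> A v = {}"
  shows "card {S \<in> Pow P. \<forall>u\<in>I. S \<inter> A u \<noteq> B u} * 2 ^ (k * card I) = 2 ^ card P * (2 ^ k - 1) ^ card I"
  using assms
proof (induction I arbitrary: P rule: finite_induct)
  case empty
  have "{S \<in> Pow P. \<forall>u\<in>{}. S \<inter> A u \<noteq> B u} = Pow P" by auto
  then show ?case using empty by (simp add: card_Pow)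
next
  case (insert v I)
  define Q where "Q = P - A v"
  let ?L = "{S \<in> Pow P. \<forall>u\<in>insert v I. S \<inter> A u \<noteq> B u}"
  let ?R = "{S \<in> Pow Q. \<forall>u\<in>I. S \<inter> A u \<noteq> B u}"
  have AvP: "A v \<subseteq> P" and Bv: "B v \<subseteq> A v" and cAv: "card (A v) = k" using insert.prems by auto
  have fin: "finite (A v)" "finite Q" using AvP insert.prems(1) Q_def finite_subset by auto
  have AQ: "A u \<subseteq> Q" if "u \<in> I" for u
    using insert.prems(3)[of u] insert.prems(5)[of u v] insert.hyps that unfolding Q_def by blast
  have IH: "card ?R * 2 ^ (k * card I) = 2 ^ card Q * (2 ^ k - 1) ^ card I"
    using insert.prems AQ fin by (intro insert.IH) auto
  \<comment> \<open>The traces on \<open>A v\<close> and on \<open>Q\<close> determine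
    \<open>S\<close>. The condition for \<open>v\<close> excludes one value of the first trace; the
    other conditions see only the second.\<close>
  have "bij_betw (\<lambda>S. (S \<inter> A v, S \<inter> Q)) ?L ((Pow (A v) - {B v}) \<times> ?R)"
  proof (rule bij_betw_byWitness[where f' = "\<lambda>(X, Y). X \<union> Y"])
    show "\<forall>S\<in>?L. (case (S \<inter> A v, S \<inter> Q) of (X, Y) \<Rightarrow> X \<union> Y) = S"
      using AvP by (auto simp: Q_def)
    show "\<forall>Z\<in>(Pow (A v) - {B v}) \<times> ?R.
        ((case Z of (X, Y) \<Rightarrow> X \<union> Y) \<inter> A v, (case Z of (X, Y) \<Rightarrow> X \<union> Y) \<inter> Q) = Z"
      by (auto simp: Q_def)
    have "S \<inter> Q \<inter> A u = S \<inter> A u" if "u \<in> I" for S u using AQ[OF that] by auto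
    then show "(\<lambda>S. (S \<inter> A v, S \<inter> Q)) ` ?L \<subseteq> (Pow (A v) - {B v}) \<times> ?R" by auto
    have "(X \<union> Y) \<inter> A u = Y \<inter> A u" if "u \<in> I" "X \<subseteq> A v" for X Y u
      using AQ[OF that(1)] that(2) by (auto simp: Q_def)
    moreover have "(X \<union> Y) \<inter> A v = X" if "X \<subseteq> A v" "Y \<subseteq> Q" for X Y
      using that by (auto simp: Q_def)
    moreover have "Q \<subseteq> P" by (auto simp: Q_def)
    ultimately show "(\<lambda>(X, Y). X \<union> Y) ` ((Pow (A v) - {B v}) \<times> ?R) \<subseteq> ?L"
      using AvP by (auto simp: image_subset_iff)
  qed
  then have "card ?L = card (Pow (A v) - {B v}) * card ?R"
    by (simp add: bij_betw_same_card card_cartesian_product)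
  also have "card (Pow (A v) - {B v}) = 2 ^ k - 1"
    using Bv fin cAv by (simp add: card_Pow)
  finally have L: "card ?L = (2 ^ k - 1) * card ?R" .
  have cP: "card P = k + card Q"
    using AvP insert.prems(1) cAv card_Diff_subset[OF fin(1) AvP] card_mono[OF insert.prems(1) AvP]
    by (simp add: Q_def)
  have "card ?L * 2 ^ (k * card (insert v I)) = (2 ^ k - 1) * 2 ^ k * (card ?R * 2 ^ (k * card I))"
    using L insert.hyps by (simp add: power_add mult_ac)
  also have "\<dots> = 2 ^ card P * (2 ^ k - 1) ^ card (insert v I)"
    unfolding IH using insert.hyps cP by (simp add: power_add mult_ac)
  finally show ?case .
qed

text \<open>A union bound: the hypothesis, divided by its right-hand side, makes the expected number
  of undominated \<open>k\<close>-sets in a random tournament less than 1.\<close>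

lemma exists_schutte_tournament:
  fixes n k :: nat
  assumes "(n choose k) * (2 ^ k - 1) ^ (n - k) < (2::nat) ^ (k * (n - k))"
  shows "\<exists>E. tournament {..<n} E \<and> (\<forall>U. U \<subseteq> {..<n} \<and> card U = k \<longrightarrow> (\<exists>u<n. dominates E u U))"
proof -
  \<comment> \<open>Orientations are encoded as subsets \<open>S\<close> of the increasing pairs
    \<open>P\<close>: pairs in \<open>S\<close> point upwards, all others are reversed.\<close>
  define P where "P = {(a, b). a < b \<and> b < n}"
  define E where "E S = S \<union> {(b, a) | a b. (a, b) \<in> P - S}" for S
  \<comment> \<open>For distinct \<open>u\<close> outside \<open>U\<close>, the edges joining
    \<open>u\<close> to \<open>U\<close> form disjoint sets, which gives the independence used in
    the count.\<close>
  define bad where "bad U = {S \<in> Pow P. \<forall>u\<in>{..<n} - U. \<not> dominates (E S) u U}" for U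
  define N where "N = {U. U \<subseteq> {..<n} \<and> card U = k}"
  have finP: "finite P" by (rule finite_subset[of _ "{..<n} \<times> {..<n}"]) (auto simp: P_def)
  have tour: "tournament {..<n} (E S)" if "S \<subseteq> P" for S
    unfolding tournament_def
  proof (intro conjI)
    show "E S \<subseteq> {..<n} \<times> {..<n}" using that by (auto simp: E_def P_def)
    have "(b, a) \<notin> S" if "(a, b) \<in> S" for a b
      using subsetD[OF \<open>S \<subseteq> P\<close> that] subsetD[OF \<open>S \<subseteq> P\<close>, of "(b, a)"] by (auto simp: P_def)
    then show "asym (E S)" by (auto simp: E_def P_def intro!: asymI)
    show "total_on {..<n} (E S)" by (auto simp: total_on_def E_def P_def)
  qed
  have card_bad: "card (bad U) * 2 ^ (k * (n - k)) = 2 ^ card P * (2 ^ k - 1) ^ (n - k)" if "U \<in> N" for U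
  proof -
    \<comment> \<open>\<open>p u w\<close> is the element of \<open>P\<close> that encodes the edge
      between \<open>u\<close> and \<open>w\<close>. \<open>A u\<close> collects the edges from
      \<open>u\<close> to \<open>U\<close>, and \<open>B u\<close> is the one trace on them for
      which all these edges leave \<open>u\<close>.\<close>
    define p where "p u w = (min u w, max u w)" for u w :: nat
    define A where "A u = p u ` U" for u
    define B where "B u = p u ` {w \<in> U. u < w}" for u
    have inj: "inj (p u)" for u
      by (auto simp: p_def inj_def min_def max_def split: if_splits)
    have U: "U \<subseteq> {..<n}" "card U = k" using that by (auto simp: N_def)
    have finU: "finite U" using U(1) finite_subset by blast
    have iff: "dominates (E S) u U \<longleftrightarrow> S \<inter> A u = B u" if "S \<in> Pow P" "u \<in> {..<n} - U" for S u
    proof -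
      have 1: "(u, w) \<in> E S \<longleftrightarrow> (p u w \<in> S \<longleftrightarrow> u < w)" if w: "w \<in> U" for w
      proof -
        have "u \<noteq> w" "u < n" "w < n" using w U \<open>u \<in> _\<close> by auto
        moreover have "(w, u) \<notin> S" if "u < w"
          using \<open>S \<in> Pow P\<close> subsetD[of S P "(w, u)"] that by (auto simp: P_def)
        moreover have "(u, w) \<notin> S" if "w < u"
          using \<open>S \<in> Pow P\<close> subsetD[of S P "(u, w)"] that by (auto simp: P_def)
        ultimately show ?thesis
          by (cases "u < w") (auto simp: E_def P_def p_def)
      qed
      have "S \<inter> A u = p u ` {w \<in> U. p u w \<in> S}" by (auto simp: A_def)
      then have "S \<inter> A u = B u \<longleftrightarrow> {w \<in> U. p u w \<in> S} = {w \<in> U. u < w}"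
        using inj by (simp add: B_def inj_image_eq_iff)
      then show ?thesis using 1 by (auto simp: dominates_def)
    qed
    have "bad U = {S \<in> Pow P. \<forall>u\<in>{..<n} - U. S \<inter> A u \<noteq> B u}"
      using iff by (auto simp: bad_def)
    moreover have "card ({..<n} - U) = n - k" using U finU by (simp add: card_Diff_subset)
    moreover have "card {S \<in> Pow P. \<forall>u\<in>{..<n} - U. S \<inter> A u \<noteq> B u} * 2 ^ (k * card ({..<n} - U))
        = 2 ^ card P * (2 ^ k - 1) ^ card ({..<n} - U)"
    proof (rule card_Pow_avoiding_patterns)
      fix u assume u: "u \<in> {..<n} - U"
      show "B u \<subseteq> A u" by (auto simp: A_def B_def)
      show "A u \<subseteq> P"
      proof
        fix x assume "x \<in> A u"
        then obtain w where w: "w \<in> U" "x = p u w" by (auto simp: A_def)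
        then have "u \<noteq> w" "u < n" "w < n" using u U by auto
        then show "x \<in> P" using w by (auto simp: P_def p_def min_def max_def)
      qed
      have "inj_on (p u) U" using inj inj_on_subset by blast
      then show "card (A u) = k" using U by (simp add: A_def card_image)
      fix v assume "v \<in> {..<n} - U" "u \<noteq> v"
      with u show "A u \<inter> A v = {}"
        by (auto simp: A_def p_def min_def max_def split: if_splits)
    qed (use finP in auto)
    ultimately show ?thesis by simp
  qed
  have finN: "finite N" by (rule finite_subset[of _ "Pow {..<n}"]) (auto simp: N_def)
  have cN: "card N = n choose k" by (simp add: N_def n_subsets)
  \<comment> \<open>Union bound over all \<open>k\<close>-sets, scaled by the common factor so that
    \<open>card_bad\<close> applies. The total is below the number of orientations, so some
    orientation is bad for no \<open>U\<close>.\<close>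
  have "card (\<Union>U\<in>N. bad U) * 2 ^ (k * (n - k)) \<le> (\<Sum>U\<in>N. card (bad U)) * 2 ^ (k * (n - k))"
    using card_UN_le[OF finN, of bad] by simp
  also have "\<dots> = (\<Sum>U\<in>N. card (bad U) * 2 ^ (k * (n - k)))" by (simp add: sum_distrib_right)
  also have "\<dots> = (n choose k) * (2 ^ card P * (2 ^ k - 1) ^ (n - k))"
    using card_bad cN by simp
  also have "\<dots> = 2 ^ card P * ((n choose k) * (2 ^ k - 1) ^ (n - k))" by (simp add: mult_ac)
  also have "\<dots> < 2 ^ card P * 2 ^ (k * (n - k))" using assms by simp
  finally have "card (\<Union>U\<in>N. bad U) < card (Pow P)" using finP by (simp add: card_Pow)
  moreover have "(\<Union>U\<in>N. bad U) \<subseteq> Pow P" by (auto simp: bad_def)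
  ultimately obtain S where "S \<in> Pow P" "S \<notin> (\<Union>U\<in>N. bad U)"
    by (metis less_irrefl subsetI subset_antisym)
  then have "tournament {..<n} (E S)" "\<forall>U. U \<subseteq> {..<n} \<and> card U = k \<longrightarrow> (\<exists>u<n. dominates (E S) u U)"
    using tour by (auto simp: bad_def N_def)
  then show ?thesis by blast
qed

lemma le_4_square_exp: "(j::nat) \<le> 4 * j\<^sup>2 * 2 ^ j"
proof (cases "j = 0")
  case False
  then have "j * 1 \<le> j * (4 * j * 2 ^ j)" by (intro mult_le_mono2) simp
  then show ?thesis by (simp add: power2_eq_square mult_ac)
qed simp

text \<open>Bounding the binomial by \<open>n ^ j\<close> and \<open>1 - x\<close> by
  \<open>exp (- x)\<close> reduces the claim to \<open>j * ln n < (n - j) / 2 ^ j\<close>. The right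
  side is \<open>4 * j\<^sup>2 - j / 2 ^ j\<close>, while \<open>ln n \<le> 3 * j\<close>; the spare
  \<open>j\<^sup>2\<close> absorbs \<open>j / 2 ^ j\<close>.\<close>

lemma erdos_inequality:
  fixes j :: nat
  assumes "j > 0" and n: "n = 4 * j\<^sup>2 * 2 ^ j"
  shows "(n choose j) * (2 ^ j - 1) ^ (n - j) < (2::nat) ^ (j * (n - j))"
proof -
  have jn: "j \<le> n" using le_4_square_exp n by simp
  have npos: "n > 0" using assms by simp
  have rn: "real n = 4 * (real j)\<^sup>2 * 2 ^ j" by (simp add: n)
  have j1: "1 \<le> real j" using assms by simp
  have "ln (real n) = ln 4 + 2 * ln (real j) + real j * ln 2"
    using j1 by (simp add: rn ln_mult ln_realpow)
  also have "ln 4 = 2 * ln (2::real)" using ln_realpow[of 2 2] by simp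
  \<comment> \<open>From \<open>ln 2 \<le> 1\<close> and \<open>ln j \<le> j - 1\<close>; the
    constants cancel and leave \<open>3 * j\<close>.\<close>
  also have "2 * ln 2 + 2 * ln (real j) + real j * ln 2 \<le> 2 * 1 + 2 * (real j - 1) + real j * (1::real)"
    using ln_le_minus_one[of "real j"] ln_le_minus_one[of "2::real"] j1
    by (intro add_mono mult_left_mono) auto
  finally have lnn: "ln (real n) \<le> 3 * real j" by simp
  have "real j * ln (real n) \<le> real j * (3 * real j)" using lnn by (intro mult_left_mono) auto
  also have "\<dots> = 4 * (real j)\<^sup>2 - real j * real j" by (simp add: power2_eq_square)
  also have "\<dots> < 4 * (real j)\<^sup>2 - real j / 2 ^ j"
  proof -
    have "real j / 2 ^ j < real j / 1" using assms by (intro divide_strict_left_mono) auto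
    also have "\<dots> \<le> real j * real j" using j1 by (simp add: mult_le_cancel_left1)
    finally show ?thesis by simp
  qed
  also have "\<dots> = (real n - real j) / 2 ^ j" by (simp add: rn diff_divide_distrib)
  finally have key: "real j * ln (real n) < real (n - j) / 2 ^ j" using jn by (simp add: of_nat_diff)
  have "real (n choose j) \<le> real n ^ j"
    using binomial_le_pow[OF jn] by (metis of_nat_le_iff of_nat_power)
  also have "\<dots> = exp (real j * ln (real n))" using npos by (simp add: exp_of_nat_mult)
  finally have b1: "real (n choose j) \<le> exp (real j * ln (real n))" .
  have "(1 - 1 / 2 ^ j) ^ (n - j) \<le> (exp (- (1 / 2 ^ j)) :: real) ^ (n - j)"
    using exp_ge_add_one_self[of "- (1 / 2 ^ j) :: real"] by (intro power_mono) auto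
  also have "\<dots> = exp (- (real (n - j) / 2 ^ j))" by (simp flip: exp_of_nat_mult)
  finally have b2: "(1 - 1 / 2 ^ j) ^ (n - j) \<le> exp (- (real (n - j) / 2 ^ j))" .
  have "real (n choose j) * (1 - 1 / 2 ^ j) ^ (n - j)
      \<le> exp (real j * ln (real n)) * exp (- (real (n - j) / 2 ^ j))"
    using b1 b2 by (intro mult_mono) auto
  also have "\<dots> < 1" using key by (simp flip: exp_add)
  finally have lt: "real (n choose j) * (1 - 1 / 2 ^ j) ^ (n - j) < 1" .
  \<comment> \<open>Back to the naturals: each factor \<open>2 ^ j - 1\<close> equals
    \<open>2 ^ j * (1 - 1 / 2 ^ j)\<close>.\<close>
  have "real ((n choose j) * (2 ^ j - 1) ^ (n - j)) = real (n choose j) * (2 ^ j * (1 - 1 / 2 ^ j)) ^ (n - j)"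
    by (simp add: of_nat_diff algebra_simps)
  also have "\<dots> = (real (n choose j) * (1 - 1 / 2 ^ j) ^ (n - j)) * 2 ^ (j * (n - j))"
    by (simp add: power_mult_distrib power_mult mult_ac)
  also have "\<dots> < 1 * 2 ^ (j * (n - j))" using lt by (intro mult_strict_right_mono) auto
  finally show ?thesis by (metis mult_1 of_nat_less_iff of_nat_numeral of_nat_power)
qed

lemma schutte_tournament_4_square_exp:
  assumes "j > 0"
  obtains T where "tournament {..<4 * j\<^sup>2 * 2 ^ j} (T 0)" "schutte_property {..<4 * j\<^sup>2 * 2 ^ j} 1 T j"
    "j \<le> 4 * j\<^sup>2 * 2 ^ j"
proof -
  let ?n = "4 * j\<^sup>2 * 2 ^ j"
  obtain E where E: "tournament {..<?n} E"
      "\<forall>U. U \<subseteq> {..<?n} \<and> card U = j \<longrightarrow> (\<exists>u<?n. dominates E u U)"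
    using exists_schutte_tournament[OF erdos_inequality[OF assms refl]] by blast
  have "schutte_property {..<?n} 1 (\<lambda>_. E) j"
    using E(2) by (auto simp: schutte_property_def)
  then show thesis using that[of "\<lambda>_. E"] E(1) le_4_square_exp by simp
qed

lemma schutte_number_1_le:
  assumes "j > 0"
  shows "schutte_number 1 j \<le> 4 * j\<^sup>2 * 2 ^ j"
proof -
  obtain T where "tournament {..<4 * j\<^sup>2 * 2 ^ j} (T 0)" "schutte_property {..<4 * j\<^sup>2 * 2 ^ j} 1 T j"
    "j \<le> 4 * j\<^sup>2 * 2 ^ j" using schutte_tournament_4_square_exp[OF assms] .
  then show ?thesis using schutte_number_le[of "{..<4 * j\<^sup>2 * 2 ^ j}" j 1 T] by simp
qed

section \<open>Disjoint copies of an optimal tournament\<close>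

text \<open>The \<open>LEAST\<close> in the definition is informative only once some order is known
  to qualify; the counting argument supplies one for \<open>j > 0\<close>.\<close>

lemma schutte_number_1_attained:
  obtains W :: "nat set" and R where "finite W" "card W = schutte_number 1 j" "j \<le> card W"
    "tournament W R" "\<forall>U. U \<subseteq> W \<and> card U = j \<longrightarrow> (\<exists>u\<in>W. dominates R u U)"
proof -
  let ?P = "\<lambda>n. j \<le> n \<and> (\<exists>(V :: nat set) T. finite V \<and> card V = n \<and>
        (\<forall>i<1. tournament V (T i)) \<and> schutte_property V 1 T j)"
  have "\<exists>n. ?P n"
  proof (cases "j = 0")
    case True
    \<comment> \<open>The general size \<open>4 * j\<^sup>2 * 2 ^ j\<close> is 0 here, yet the empty
      set still requires a dominating vertex.\<close>
    have "?P 1"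
      using True by (intro conjI exI[of _ "{0}"] exI[of _ "\<lambda>_. {}"])
        (auto simp: tournament_def schutte_property_def dominates_def)
    then show ?thesis by blast
  next
    case False
    then obtain T where "tournament {..<4 * j\<^sup>2 * 2 ^ j} (T 0)"
      "schutte_property {..<4 * j\<^sup>2 * 2 ^ j} 1 T j" "j \<le> 4 * j\<^sup>2 * 2 ^ j"
      using schutte_tournament_4_square_exp by blast
    then have "?P (4 * j\<^sup>2 * 2 ^ j)"
      by (intro conjI exI[of _ "{..<4 * j\<^sup>2 * 2 ^ j}"] exI[of _ T]) auto
    then show ?thesis by blast
  qed
  then have "?P (schutte_number 1 j)" unfolding schutte_number_def by (rule LeastI_ex)
  then obtain W :: "nat set" and T where W: "finite W" "card W = schutte_number 1 j" "j \<le> card W"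
    "tournament W (T 0)" "schutte_property W 1 T j" by auto
  have "\<exists>u\<in>W. dominates (T 0) u U" if "U \<subseteq> W" "card U = j" for U
    using W(1,5) that finite_subset[of U W] unfolding schutte_property_def by auto
  with W show thesis using that by blast
qed

lemma schutte_number_le_div:
  assumes "m > 0"
  shows "schutte_number m k \<le> m * schutte_number 1 (k div m)"
proof -
  define j where "j = k div m"
  obtain W :: "nat set" and R where W: "finite W" "card W = schutte_number 1 j" "j \<le> card W"
    "tournament W R" and dom: "\<forall>U. U \<subseteq> W \<and> card U = j \<longrightarrow> (\<exists>u\<in>W. dominates R u U)"
    by (rule schutte_number_1_attained[of j])
  have sub: "R \<subseteq> W \<times> W" and as: "asym R" and tot: "total_on W R"
    using W(4) by (auto simp: tournament_def)
  define V where "V = {..<m} \<times> W"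
  \<comment> \<open>Copies carry \<open>R\<close>, and copy \<open>i\<close> beats every other copy.
    Two copies other than \<open>i\<close> are oriented by index, an arbitrary choice that makes the
    relation total.\<close>
  define T where "T i = {((a, x), (b, y)) | a x b y. a < m \<and> b < m \<and> x \<in> W \<and> y \<in> W \<and>
     (a = b \<and> (x, y) \<in> R \<or> a \<noteq> b \<and> (a = i \<or> b \<noteq> i \<and> a < b))}" for i :: nat
  have kj: "k < m * (j + 1)" using assms by (simp add: j_def dividend_less_times_div)
  \<comment> \<open>A smaller set extends to \<open>j\<close> elements inside \<open>W\<close>, and
    domination passes to subsets.\<close>
  have dom_le: "\<exists>u\<in>W. dominates R u U" if U: "U \<subseteq> W" "card U \<le> j" for U
  proof -
    obtain U' where "U \<subseteq> U'" "U' \<subseteq> W" "card U' = j"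
      using U W(1,3) exists_subset_between by metis
    with dom show ?thesis by (metis dominates_def subsetD)
  qed
  \<comment> \<open>The dominator of a \<open>j\<close>-set lies outside it. The extra vertex yields
    \<open>k < m * (j + 1) \<le> card V\<close>, the size condition in
    \<open>schutte_number\<close>.\<close>
  have Wj: "j + 1 \<le> card W"
  proof -
    obtain U where U: "U \<subseteq> W" "card U = j" using W(3) by (meson obtain_subset_with_card_n)
    with dom obtain u where u: "u \<in> W" "dominates R u U" by blast
    then have "u \<notin> U" using as by (auto simp: dominates_def dest: asymD)
    with u(1) U(1) have "U \<subset> W" by blast
    from psubset_card_mono[OF W(1) this] U(2) show ?thesis by simp
  qed
  have cV: "card V = m * card W" by (simp add: V_def card_cartesian_product)
  have "m * (j + 1) \<le> m * card W" using Wj by (rule mult_le_mono2)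
  with kj cV have kV: "k \<le> card V" by linarith
  have tour: "tournament V (T i)" for i
    unfolding tournament_def
  proof (intro conjI)
    show "T i \<subseteq> V \<times> V" by (auto simp: T_def V_def)
    show "asym (T i)" using as by (auto simp: T_def intro!: asymI dest: asymD)
    show "total_on V (T i)" using tot by (auto simp: total_on_def T_def V_def)
  qed
  have "schutte_property V m T k"
    unfolding schutte_property_def
  proof (intro allI impI, elim conjE)
    fix U assume U: "U \<subseteq> V" "finite U" "card U = k"
    define Us where "Us i = {w. (i, w) \<in> U}" for i
    have UsW: "Us i \<subseteq> W" for i using U(1) by (auto simp: Us_def V_def)
    have "U = Sigma {..<m} Us" using U(1) by (auto simp: Us_def V_def)
    then have "k = (\<Sum>i<m. card (Us i))"
      using U(3) UsW W(1) by (metis card_SigmaI finite_lessThan finite_subset)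
    \<comment> \<open>Pigeonhole: if every trace had at least \<open>j + 1\<close> elements, their
      sum would reach \<open>m * (j + 1) > k\<close>.\<close>
    then have "\<exists>i<m. card (Us i) \<le> j"
      using kj sum_bounded_below[of "{..<m}" "j + 1" "\<lambda>i. card (Us i)"] by force
    then obtain i u where iu: "i < m" "u \<in> W" "dominates R u (Us i)"
      using dom_le UsW by blast
    have "dominates (T i) (i, u) U"
      unfolding dominates_def
    proof
      fix x assume x: "x \<in> U"
      obtain b w where bw: "x = (b, w)" by (cases x)
      then show "((i, u), x) \<in> T i"
        using x iu U(1) by (auto simp: T_def V_def dominates_def Us_def)
    qed
    with iu show "\<exists>i<m. \<exists>u\<in>V. dominates (T i) u U" by (auto simp: V_def)
  qed
  then have "schutte_number m k \<le> card V"
    using W(1) kV tour by (intro schutte_number_le) (auto simp: V_def)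
  with cV W(2) show ?thesis by (simp add: j_def)
qed

section \<open>The rounded quotient and the asymptotic bound\<close>

text \<open>With \<open>k = m * q + r\<close> and \<open>r < m\<close>, the quotient is
  \<open>q - (m - 1 - r) / m\<close>, which lies above \<open>q - 1\<close> and at most at
  \<open>q\<close>.\<close>

lemma nat_ceiling_eq_div:
  fixes m k :: nat
  assumes "m > 0"
  shows "nat \<lceil>(real k - real m + 1) / real m\<rceil> = k div m"
proof -
  have "k = m * (k div m) + k mod m" by simp
  then have k: "real k = real m * real (k div m) + real (k mod m)"
    by (metis of_nat_add of_nat_mult)
  have "real (k mod m) + 1 \<le> real m" using mod_less_divisor[OF assms, of k] by linarith
  then have "\<lceil>(real k - real m + 1) / real m\<rceil> = int (k div m)"
    using assms by (intro ceiling_unique) (auto simp: k field_simps)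
  then show ?thesis by simp
qed

theorem theorem2p8:
  fixes m :: nat
  assumes "m > 0"
  shows "(\<forall>k::nat. k > 0 \<longrightarrow>
            schutte_number m k
              \<le> m * schutte_number 1 (nat \<lceil>(real k - real m + 1) / real m\<rceil>)) \<and>
         (\<exists>h :: nat \<Rightarrow> real. h \<in> O(\<lambda>_. 1) \<and>
            (\<forall>\<^sub>F k in sequentially.
               real (schutte_number m k)
                 \<le> (ln 2 + h k) * ((real k)\<^sup>2 / real m) * 2 powr (real k / real m)))"
\<comment> \<open>The bounded term is added to \<open>ln 2\<close>, so a constant \<open>h\<close>
  can raise the coefficient to the 4 of the counting bound.\<close>
proof (intro conjI exI[of _ "\<lambda>_. 4 - ln 2 :: real"])
  show "\<forall>k::nat. k > 0 \<longrightarrow> schutte_number m k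
              \<le> m * schutte_number 1 (nat \<lceil>(real k - real m + 1) / real m\<rceil>)"
    using schutte_number_le_div[OF assms] nat_ceiling_eq_div[OF assms] by simp
  show "(\<lambda>_. 4 - ln 2 :: real) \<in> O(\<lambda>_::nat. 1)" by simp
  show "\<forall>\<^sub>F k in sequentially. real (schutte_number m k)
      \<le> (ln 2 + (4 - ln 2)) * ((real k)\<^sup>2 / real m) * 2 powr (real k / real m)"
    \<comment> \<open>\<open>k \<ge> m\<close> forces \<open>j > 0\<close>; at \<open>j = 0\<close>
      the counting bound would read \<open>schutte_number 1 0 \<le> 0\<close>, which is
      false.\<close>
    using eventually_ge_at_top[of m]
  proof eventually_elim
    case (elim k)
    define j where "j = k div m"
    have j: "j > 0" using elim assms by (simp add: j_def div_greater_zero_iff)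
    have jk: "real j \<le> real k / real m" unfolding j_def by (rule of_nat_div_le_of_nat)
    have "schutte_number m k \<le> m * (4 * j\<^sup>2 * 2 ^ j)"
      using schutte_number_le_div[OF assms, of k] schutte_number_1_le[OF j]
      by (metis j_def le_trans mult_le_mono2)
    then have "real (schutte_number m k) \<le> real (m * (4 * j\<^sup>2 * 2 ^ j))" by (simp only: of_nat_le_iff)
    also have "\<dots> = real m * 4 * (real j)\<^sup>2 * 2 powr real j" by (simp add: powr_realpow)
    \<comment> \<open>The \<open>m\<close> copies contribute a factor \<open>m\<close> and the
      square a factor \<open>1 / m\<^sup>2\<close>, leaving \<open>k\<^sup>2 / m\<close>.\<close>
    also have "\<dots> \<le> real m * 4 * (real k / real m)\<^sup>2 * 2 powr (real k / real m)"
      using jk by (intro mult_mono power_mono) auto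
    also have "\<dots> = 4 * ((real k)\<^sup>2 / real m) * 2 powr (real k / real m)"
      using assms by (simp add: power2_eq_square)
    finally show ?case by simp
  qed
qed

end
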